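(* Let $\{\langle X_t,G_t\rangle\}_{t\ge 0}$, $G_t=(\mathbb{N},E,C_t)$, be a proper, monotone decreasing, possibly adaptive random walk in changing environment on $\mathbb{N}$, where $E=\{\{j,j+1\}:j\ge 0\}$. Suppose that $G_0$ is recurrent and that the process is bounded from below by $G_\infty=(\mathbb{N},E,C_\infty)$ with $C_\infty=c\,C_0$ for some constant $c>0$ (that is, $C_t(e)\ge c\,C_0(e)$ for all $e\in E$ and all $t$, almost surely). Then the walk is recurrent, i.e. almost surely $X_t$ visits every vertex of $\mathbb{N}$ infinitely many times.
   Context: A random walk in changing environment (RWCE) on a graph $G=(V,E)$ is a stochastic process $\{\langle X_t,G_t\rangle\}_{t=0}^\infty$ where $X_t\in V$ and $G_t=(V,E,C_t)$ is the graph $G$ equipped with a (random) conductance function $C_t:E\to[0,\infty)$, with total conductance at each vertex finite, such that for all $t$ and $v$, $$\mathbb{P}(X_{t+1}=v\mid \langle X_0,G_0\rangle,\dots,\langle X_t,G_t\rangle)=\frac{C_t(X_t,v)}{\sum_{e\in E: X_t\in e}C_t(e)}.$$ The conductances $C_t$ may depend on the whole history of the process and on extra randomness; "possibly adaptive" means no restriction is placed on this dependence. The RWCE is proper if $0<C_t(e)<\infty$ for all $t$ and $e$. It is monotone decreasing if $C_{t+1}\le C_t$ (edgewise) almost surely for all $t$. Here $\mathbb{N}=\{0,1,2,\dots\}$. The bounding graph $G_\infty$ is deterministic (so $C_0$ is deterministic). A weighted graph is called recurrent if the usual weighted (reversible) random walk on it is recurrent; for $\mathbb{N}$ with positive conductances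 $C_0$ this means $\sum_{j\ge0}1/C_0(j,j+1)=\infty$. *)

theory Defs
  imports "HOL-Probability.Probability"
begin

text \<open>
  An undirected graph is given by a vertex set \<open>V\<close> and a set \<open>E\<close> of edges, each
  edge being the set of its endpoints.  A conductance function is a map \<open>c\<close> from
  edges to the reals; only its values on \<open>E\<close> are ever used.
\<close>

definition edge_conductance :: "'v set set \<Rightarrow> ('v set \<Rightarrow> real) \<Rightarrow> 'v \<Rightarrow> 'v \<Rightarrow> real" where
  "edge_conductance E c x y = (if {x, y} \<in> E then c {x, y} else 0)"

definition vertex_conductance :: "'v set set \<Rightarrow> ('v set \<Rightarrow> real) \<Rightarrow> 'v \<Rightarrow> real" where
  "vertex_conductance E c x = (\<Sum>\<^sub>\<infinity>e\<in>{e \<in> E. x \<in> e}. c e)"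

definition transition_prob :: "'v set set \<Rightarrow> ('v set \<Rightarrow> real) \<Rightarrow> 'v \<Rightarrow> 'v \<Rightarrow> real" where
  "transition_prob E c x y = edge_conductance E c x y / vertex_conductance E c x"


subsection \<open>Recurrence of a weighted graph\<close>

text \<open>
  One step of the weighted random walk from \<open>x\<close>.  This is meaningful only if the
  conductances at \<open>x\<close> are nonnegative with finite positive sum; otherwise
  \<^const>\<open>embed_pmf\<close> is unspecified.
\<close>

definition weighted_step :: "'v set set \<Rightarrow> ('v set \<Rightarrow> real) \<Rightarrow> 'v \<Rightarrow> 'v pmf" where
  "weighted_step E c x = embed_pmf (transition_prob E c x)"

text \<open>
  The joint law of the positions at times \<open>1, \<dots>, n\<close> of the weighted random walk
  that is at \<open>x\<close> at time \<open>0\<close>.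
\<close>

primrec weighted_walk :: "'v set set \<Rightarrow> ('v set \<Rightarrow> real) \<Rightarrow> nat \<Rightarrow> 'v \<Rightarrow> 'v list pmf" where
  "weighted_walk E c 0 x = return_pmf []"
| "weighted_walk E c (Suc n) x =
     bind_pmf (weighted_step E c x) (\<lambda>y. map_pmf ((#) y) (weighted_walk E c n y))"

text \<open>
  Recurrence: started at any vertex, the walk almost surely returns to it.  The
  probability of ever returning is the limit of the probabilities of returning
  by time \<open>n\<close>.
\<close>

definition recurrent_graph :: "'v set \<Rightarrow> 'v set set \<Rightarrow> ('v set \<Rightarrow> real) \<Rightarrow> bool" where
  "recurrent_graph V E c \<longleftrightarrow>
     (\<forall>v\<in>V. (\<lambda>n. measure_pmf.prob (weighted_walk E c n v) {xs. v \<in> set xs}) \<longlonglongrightarrow> 1)"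


subsection \<open>Random walks in changing environment\<close>

text \<open>The $\sigma$-algebra generated by \<open>X 0, C 0, \<dots>, X t, C t\<close>.\<close>

definition history ::
  "'w measure \<Rightarrow> 'v set \<Rightarrow> 'v set set \<Rightarrow> (nat \<Rightarrow> 'w \<Rightarrow> 'v) \<Rightarrow> (nat \<Rightarrow> 'w \<Rightarrow> 'v set \<Rightarrow> real)
     \<Rightarrow> nat \<Rightarrow> 'w measure" where
  "history M V E X C t = sigma (space M)
     ({X s -` A \<inter> space M | s A. s \<le> t \<and> A \<subseteq> V} \<union>
      {(\<lambda>\<omega>. C s \<omega> e) -` B \<inter> space M | s e B. s \<le> t \<and> e \<in> E \<and> B \<in> sets borel})"

text \<open>
  Nothing is assumed about how \<open>C t\<close> depends on the past, and the probability
  space may carry randomness beyond \<open>X\<close> and \<open>C\<close>, so the environment may be adaptive.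
\<close>

locale rwce = prob_space M for M :: "'w measure" +
  fixes V :: "'v set" and E :: "'v set set"
    and X :: "nat \<Rightarrow> 'w \<Rightarrow> 'v" and C :: "nat \<Rightarrow> 'w \<Rightarrow> 'v set \<Rightarrow> real"
  assumes edges: "e \<in> E \<Longrightarrow> \<exists>u\<in>V. \<exists>v\<in>V. u \<noteq> v \<and> e = {u, v}"
    and X_measurable: "X t \<in> M \<rightarrow>\<^sub>M count_space V"
    and C_measurable: "e \<in> E \<Longrightarrow> (\<lambda>\<omega>. C t \<omega> e) \<in> borel_measurable M"
    and C_nonneg: "\<omega> \<in> space M \<Longrightarrow> e \<in> E \<Longrightarrow> 0 \<le> C t \<omega> e"
    and C_summable: "\<omega> \<in> space M \<Longrightarrow> v \<in> V \<Longrightarrow> C t \<omega> summable_on {e \<in> E. v \<in> e}"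
    and transition: "v \<in> V \<Longrightarrow>
      AE \<omega> in M. real_cond_exp M (history M V E X C t)
          (indicator {\<omega> \<in> space M. X (Suc t) \<omega> = v}) \<omega>
        = transition_prob E (C t \<omega>) (X t \<omega>) v"

definition proper_env :: "'w measure \<Rightarrow> 'v set set \<Rightarrow> (nat \<Rightarrow> 'w \<Rightarrow> 'v set \<Rightarrow> real) \<Rightarrow> bool" where
  "proper_env M E C \<longleftrightarrow> (AE \<omega> in M. \<forall>t. \<forall>e\<in>E. 0 < C t \<omega> e)"

definition monotone_decreasing_env ::
    "'w measure \<Rightarrow> 'v set set \<Rightarrow> (nat \<Rightarrow> 'w \<Rightarrow> 'v set \<Rightarrow> real) \<Rightarrow> bool" where
  "monotone_decreasing_env M E C \<longleftrightarrow> (AE \<omega> in M. \<forall>t. \<forall>e\<in>E. C (Suc t) \<omega> e \<le> C t \<omega> e)"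

definition env_bounded_below ::
    "'w measure \<Rightarrow> 'v set set \<Rightarrow> (nat \<Rightarrow> 'w \<Rightarrow> 'v set \<Rightarrow> real) \<Rightarrow> ('v set \<Rightarrow> real) \<Rightarrow> bool" where
  "env_bounded_below M E C Cinf \<longleftrightarrow> (AE \<omega> in M. \<forall>t. \<forall>e\<in>E. Cinf e \<le> C t \<omega> e)"

definition recurrent_walk :: "'w measure \<Rightarrow> 'v set \<Rightarrow> (nat \<Rightarrow> 'w \<Rightarrow> 'v) \<Rightarrow> bool" where
  "recurrent_walk M V X \<longleftrightarrow> (AE \<omega> in M. \<forall>v\<in>V. infinite {t. X t \<omega> = v})"

definition nat_edges :: "nat set set" where
  "nat_edges = {{j, Suc j} | j. True}"

end

theory Submission
  imports Defs
begin

text \<open>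
  Put \<open>g t x = (\<Sum>j=x..<N. 1 / C\<^sub>t(j,j+1))\<close>, the effective resistance from \<open>x\<close> to \<open>N\<close>.  At a fixed
  time it is harmonic on \<open>{1..<N}\<close>, and it only grows as the conductances decrease, so
  \<open>g t (X t)\<close> is a submartingale up to the exit from \<open>{1..<N}\<close>.  On exit it vanishes at \<open>N\<close> and at
  \<open>0\<close> is at most \<open>1/c\<close> times the resistance of \<open>C\<^sub>0\<close> between \<open>0\<close> and \<open>N\<close>.  Since the latter
  diverges as \<open>N\<close> grows, at any time and given any past the walk still visits \<open>0\<close> with
  conditional probability at least \<open>c\<close>.  Hence \<open>0\<close> is visited infinitely often.  The probability of a
  step from \<open>x\<close> to \<open>x + 1\<close> is bounded below uniformly in the past, so a conditional Borel-Cantelli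
  argument passes from \<open>x\<close> to \<open>x + 1\<close>; the same argument shows that bounded intervals are left.
\<close>

subsection \<open>The weighted walk on \<open>\<nat>\<close>\<close>

lemma Suc_edge_in_nat_edges [simp]: "{j, Suc j} \<in> nat_edges"
  by (auto simp: nat_edges_def)

lemma edge_in_nat_edges_iff: "{x, y} \<in> nat_edges \<longleftrightarrow> y = Suc x \<or> x = Suc y"
  by (auto simp: nat_edges_def doubleton_eq_iff)

lemma nat_edges_at_0: "{e \<in> nat_edges. 0 \<in> e} = {{0, Suc 0}}"
  by (auto simp: nat_edges_def)

lemma nat_edges_at_Suc: "{e \<in> nat_edges. Suc x \<in> e} = {{x, Suc x}, {Suc x, Suc (Suc x)}}"
  by (auto simp: nat_edges_def)

lemma nat_transition_prob_0:
  assumes "k {0, Suc 0} > 0"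
  shows "transition_prob nat_edges k 0 y = (if y = Suc 0 then 1 else 0)"
  using assms
  by (auto simp: transition_prob_def edge_conductance_def vertex_conductance_def
      nat_edges_at_0 edge_in_nat_edges_iff)

text \<open>Unlike at 0, no quotient has to be simplified to 1, so this holds with division by zero
  included and without sign conditions.\<close>

lemma nat_transition_prob_Suc:
  "transition_prob nat_edges k (Suc x) y =
     (if y = Suc (Suc x) then k {Suc x, Suc (Suc x)} / (k {x, Suc x} + k {Suc x, Suc (Suc x)})
      else if y = x then k {x, Suc x} / (k {x, Suc x} + k {Suc x, Suc (Suc x)}) else 0)"
proof -
  have "{x, Suc x} \<noteq> {Suc x, Suc (Suc x)}" by (auto simp: doubleton_eq_iff)
  then show ?thesis
    by (auto simp: transition_prob_def edge_conductance_def vertex_conductance_def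
        nat_edges_at_Suc edge_in_nat_edges_iff insert_commute)
qed

text \<open>\<open>embed_pmf\<close> is a left inverse of \<open>pmf\<close>, so exhibiting a pmf
  with the right values settles nonnegativity and total mass at once.\<close>

lemma embed_pmf_eqI: "(\<And>x. f x = pmf p x) \<Longrightarrow> embed_pmf f = p"
  using type_definition.Rep_inverse[OF td_pmf_embed_pmf, of p] by (metis ext)

lemma weighted_step_0:
  assumes "k {0, Suc 0} > 0"
  shows "weighted_step nat_edges k 0 = return_pmf (Suc 0)"
  unfolding weighted_step_def
  by (rule embed_pmf_eqI) (simp add: nat_transition_prob_0 assms indicator_def)

lemma weighted_step_Suc:
  assumes "\<And>j. k {j, Suc j} > 0"
  defines "p \<equiv> \<lambda>x. k {Suc x, Suc (Suc x)} / (k {x, Suc x} + k {Suc x, Suc (Suc x)})"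
  shows "weighted_step nat_edges k (Suc x) =
    map_pmf (\<lambda>b. if b then Suc (Suc x) else x) (bernoulli_pmf (p x))"
  unfolding weighted_step_def
proof (rule embed_pmf_eqI)
  fix y
  have pos: "k {x, Suc x} > 0" "k {Suc x, Suc (Suc x)} > 0" using assms by blast+
  then have p: "0 \<le> p x" "p x \<le> 1" "1 - p x = k {x, Suc x} / (k {x, Suc x} + k {Suc x, Suc (Suc x)})"
    by (simp_all add: p_def field_simps)
  show "transition_prob nat_edges k (Suc x) y =
      pmf (map_pmf (\<lambda>b. if b then Suc (Suc x) else x) (bernoulli_pmf (p x))) y"
    unfolding nat_transition_prob_Suc map_pmf_def pmf_bind
    using p by (simp add: p_def)
qed

section \<open>Recurrence of the initial graph forces a divergent resistance series\<close>

text \<open>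
  If the series converges, its tail \<open>h\<close> is harmonic off \<open>0\<close> and the probability of hitting \<open>0\<close>
  from \<open>x > 0\<close> is at most \<open>h x / h 0 < 1\<close>.
\<close>

lemma recurrent_nat_not_summable:
  assumes pos: "\<And>j. k {j, Suc j} > 0"
    and rec: "recurrent_graph UNIV nat_edges k"
  shows "\<not> summable (\<lambda>j. 1 / k {j, Suc j})"
proof
  assume sm: "summable (\<lambda>j. 1 / k {j, Suc j})"
  define r where "r j = 1 / k {j, Suc j}" for j
  define h where "h x = (\<Sum>j. r (j + x))" for x
  have r_pos: "r j > 0" for j using pos by (simp add: r_def)
  have sm': "summable (\<lambda>j. r (j + x))" for x
    using sm by (subst summable_iff_shift) (simp add: r_def[abs_def])
  have h_pos: "h x > 0" for x
    unfolding h_def using suminf_pos[OF sm'] r_pos by blast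
  have h_Suc: "h x = r x + h (Suc x)" for x
    using suminf_split_head[OF sm'[of x]] by (simp add: h_def)
  \<comment> \<open>With \<open>emeasure\<close>, a bind unfolds to an \<open>ennreal\<close>
    integral, which for a biased coin is a sum of two terms.\<close>
  let ?q = "\<lambda>n x. emeasure (measure_pmf (weighted_walk nat_edges k n x)) {xs. 0 \<in> set xs}"
  have vim: "emeasure (measure_pmf (map_pmf ((#) y) P)) {xs. 0 \<in> set xs} =
      (if y = 0 then 1 else emeasure (measure_pmf P) {xs. 0 \<in> set xs})" for y :: nat and P
    by (auto simp: vimage_def)
  have bound: "?q n (Suc x) \<le> ennreal (h (Suc x) / h 0)" for n x
  proof (induction n arbitrary: x)
    case 0
    then show ?case by simp
  next
    case (Suc n)
    define p where "p = k {Suc x, Suc (Suc x)} / (k {x, Suc x} + k {Suc x, Suc (Suc x)})"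
    have kp: "k {x, Suc x} > 0" "k {Suc x, Suc (Suc x)} > 0" using pos by blast+
    then have p: "0 \<le> p" "p \<le> 1" by (simp_all add: p_def)
    define u where "u y = h y / h 0" for y
    have u: "0 \<le> u y" for y using h_pos[of y] h_pos[of 0] by (simp add: u_def)
    \<comment> \<open>\<open>u 0 = 1\<close> covers the step that reaches 0; any other
      \<open>y\<close> is a successor, hence the induction hypothesis at
      \<open>y - 1\<close>.\<close>
    have le: "(if y = 0 then 1 else ?q n y) \<le> ennreal (u y)" for y
      using Suc.IH[of "y - 1"] h_pos[of 0] by (cases y) (auto simp: u_def)
    have "?q (Suc n) (Suc x) = (if Suc (Suc x) = 0 then 1 else ?q n (Suc (Suc x))) * ennreal p
        + (if x = 0 then 1 else ?q n x) * ennreal (1 - p)"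
      using p by (simp add: weighted_step_Suc[of k, OF pos] vim p_def[symmetric] bind_map_pmf del: emeasure_map_pmf)
    also have "\<dots> \<le> ennreal (u (Suc (Suc x))) * ennreal p + ennreal (u x) * ennreal (1 - p)"
      by (intro add_mono mult_right_mono le) auto
    also have "\<dots> = ennreal (u (Suc (Suc x)) * p + u x * (1 - p))"
      using p u by (simp add: ennreal_mult ennreal_plus)
    also have "u (Suc (Suc x)) * p + u x * (1 - p) = u (Suc x)"
    proof -
      have a: "u x = u (Suc x) + r x / h 0" "u (Suc x) = u (Suc (Suc x)) + r (Suc x) / h 0"
        using h_Suc[of x] h_Suc[of "Suc x"] by (simp_all add: u_def add_divide_distrib)
      \<comment> \<open>Harmonicity: both sides equal the reciprocal of the total conductance at
        \<open>Suc x\<close>.\<close>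
      have b: "r x * (1 - p) = r (Suc x) * p"
        using kp by (simp add: r_def p_def field_simps)
      have "u (Suc (Suc x)) * p + u x * (1 - p) = u (Suc x) + (r x * (1 - p) - r (Suc x) * p) / h 0"
        unfolding a by (simp add: field_simps diff_divide_distrib add_divide_distrib)
      then show ?thesis using b by simp
    qed
    finally show ?case by (simp add: u_def)
  qed
  have q0: "measure_pmf.prob (weighted_walk nat_edges k n 0) {xs. 0 \<in> set xs} \<le> h (Suc 0) / h 0" for n
  proof (cases n)
    case 0
    then show ?thesis using h_pos[of 0] h_pos[of "Suc 0"] by simp
  next
    case (Suc m)
    have "ennreal (measure_pmf.prob (weighted_walk nat_edges k n 0) {xs. 0 \<in> set xs}) = ?q n 0"
      by (simp add: measure_pmf.emeasure_eq_measure)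
    also have "\<dots> = ?q m (Suc 0)"
      by (simp add: Suc weighted_step_0[of k, OF pos] bind_return_pmf vim del: emeasure_map_pmf)
    also have "\<dots> \<le> ennreal (h (Suc 0) / h 0)" by (rule bound)
    finally show ?thesis
      using h_pos[of 0] h_pos[of "Suc 0"] by (simp add: ennreal_le_iff)
  qed
  have "(\<lambda>n. measure_pmf.prob (weighted_walk nat_edges k n 0) {xs. 0 \<in> set xs}) \<longlonglongrightarrow> 1"
    using rec by (simp add: recurrent_graph_def)
  then have "1 \<le> h (Suc 0) / h 0"
    using q0 by (intro LIMSEQ_le_const2) auto
  then show False
    using h_Suc[of 0] r_pos[of 0] h_pos[of 0] by (simp add: field_simps)
qed

subsection \<open>Walks with conductances between \<open>c C\<^sub>0\<close> and \<open>C\<^sub>0\<close>\<close>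

text \<open>The hypotheses in the form used below: the upper bound \<open>C0\<close> comes from
  monotonicity, and recurrence enters only as divergence of the resistance series.\<close>

locale nat_rwce = rwce M "UNIV :: nat set" nat_edges X C
  for M :: "'w measure" and X :: "nat \<Rightarrow> 'w \<Rightarrow> nat" and C :: "nat \<Rightarrow> 'w \<Rightarrow> nat set \<Rightarrow> real" +
  fixes C0 :: "nat set \<Rightarrow> real" and c :: real
  assumes c_pos: "c > 0"
    and C0_pos: "C0 {j, Suc j} > 0"
    and C_bounds: "AE \<omega> in M. \<forall>t j. c * C0 {j, Suc j} \<le> C t \<omega> {j, Suc j} \<and> C t \<omega> {j, Suc j} \<le> C0 {j, Suc j}"
    and C_mono: "AE \<omega> in M. \<forall>t j. C (Suc t) \<omega> {j, Suc j} \<le> C t \<omega> {j, Suc j}"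
    and C0_recurrent: "\<not> summable (\<lambda>j. 1 / C0 {j, Suc j})"
begin

section \<open>The history filtration and measurability\<close>

abbreviation F :: "nat \<Rightarrow> 'w measure" where
  "F \<equiv> history M UNIV nat_edges X C"

abbreviation X_at :: "nat \<Rightarrow> nat \<Rightarrow> 'w set" where
  "X_at t x \<equiv> {\<omega> \<in> space M. X t \<omega> = x}"

declare X_measurable [measurable]

lemma C_edge_measurable [measurable]: "(\<lambda>\<omega>. C t \<omega> {j, Suc j}) \<in> borel_measurable M"
  by (rule C_measurable) simp

lemma space_F [simp]: "space (F t) = space M"
  unfolding history_def by (rule space_measure_of) auto

lemma sets_F:
  "sets (F t) = sigma_sets (space M)
     ({X s -` A \<inter> space M | s A. s \<le> t \<and> A \<subseteq> UNIV} \<union>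
      {(\<lambda>\<omega>. C s \<omega> e) -` B \<inter> space M | s e B. s \<le> t \<and> e \<in> nat_edges \<and> B \<in> sets borel})"
  unfolding history_def by (rule sets_measure_of) auto

lemma F_mono: "s \<le> t \<Longrightarrow> sets (F s) \<subseteq> sets (F t)"
  unfolding sets_F
  by (intro sigma_sets_mono' Un_mono Collect_mono impI; elim exE conjE; intro exI conjI)
    (assumption | erule (1) order_trans)+

lemma subalgebra_F: "subalgebra M (F t)"
  unfolding subalgebra_def
proof
  show "sets (F t) \<subseteq> sets M"
    unfolding sets_F
    by (rule sets.sigma_sets_subset)
      (auto intro!: measurable_sets[OF X_measurable] measurable_sets[OF C_measurable])
qed simp

lemma sets_F_M: "A \<in> sets (F t) \<Longrightarrow> A \<in> sets M"
  using subalgebra_F[of t] by (auto simp: subalgebra_def)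

lemma X_F_measurable: "s \<le> t \<Longrightarrow> X s \<in> F t \<rightarrow>\<^sub>M count_space UNIV"
  by (rule measurableI) (auto simp: sets_F intro!: sigma_sets.Basic)

lemma X_F_measurable' [measurable]: "X t \<in> F t \<rightarrow>\<^sub>M count_space UNIV"
  by (simp add: X_F_measurable)

lemma C_F_measurable [measurable]: "(\<lambda>\<omega>. C t \<omega> {j, Suc j}) \<in> borel_measurable (F t)"
proof (rule measurableI)
  fix B :: "real set" assume "B \<in> sets borel"
  then show "(\<lambda>\<omega>. C t \<omega> {j, Suc j}) -` B \<inter> space (F t) \<in> sets (F t)"
    unfolding sets_F space_F
    by (intro sigma_sets.Basic UnI2 CollectI exI[of _ t] exI[of _ "{j, Suc j}"] exI[of _ B]) auto
qed simp

lemma C_pos: "AE \<omega> in M. \<forall>t j. 0 < C t \<omega> {j, Suc j}"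
  using C_bounds
proof eventually_elim
  case (elim \<omega>)
  then show ?case
    using c_pos C0_pos by (metis mult_pos_pos less_le_trans)
qed

text \<open>The transition law tested against a bounded function of the past. The free
  \<open>\<psi>\<close> lets a closed form replace the transition probability almost everywhere, and
  measurability is then checked on that form.\<close>

lemma step_integral:
  assumes \<phi>: "\<phi> \<in> borel_measurable (F t)" "AE \<omega> in M. \<bar>\<phi> \<omega>\<bar> \<le> K"
    and eq: "AE \<omega> in M. \<phi> \<omega> * transition_prob nat_edges (C t \<omega>) (X t \<omega>) v = \<psi> \<omega>"
    and \<psi>: "\<psi> \<in> borel_measurable M"
  shows "(\<integral>\<omega>. \<phi> \<omega> * indicator (X_at (Suc t) v) \<omega> \<partial>M) = (\<integral>\<omega>. \<psi> \<omega> \<partial>M)"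
    and "integrable M \<psi>"
proof -
  interpret S: finite_measure_subalgebra M "F t"
    by unfold_locales (rule subalgebra_F)
  have [measurable]: "\<phi> \<in> borel_measurable M"
    using measurable_from_subalg[OF subalgebra_F \<phi>(1)] .
  have int: "integrable M (\<lambda>\<omega>. \<phi> \<omega> * indicator (X_at (Suc t) v) \<omega>)"
    using \<phi>(2) by (intro integrable_const_bound[where B = "\<bar>K\<bar>"]) (auto simp: indicator_def)
  note ce = S.real_cond_exp_intg[OF int \<phi>(1)]
  have ae: "AE \<omega> in M. \<phi> \<omega> * real_cond_exp M (F t) (indicator (X_at (Suc t) v)) \<omega> = \<psi> \<omega>"
    using transition[OF UNIV_I, of t v] eq by eventually_elim simp
  have "integrable M (\<lambda>\<omega>. \<phi> \<omega> * real_cond_exp M (F t) (indicator (X_at (Suc t) v)) \<omega>)"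
    by (rule ce) measurable
  then show "integrable M \<psi>"
    using integrable_cong_AE_imp[OF _ \<psi>] ae by (metis (mono_tags, lifting) AE_cong)
  have "(\<integral>\<omega>. \<phi> \<omega> * indicator (X_at (Suc t) v) \<omega> \<partial>M) =
      (\<integral>\<omega>. \<phi> \<omega> * real_cond_exp M (F t) (indicator (X_at (Suc t) v)) \<omega> \<partial>M)"
    by (rule ce(2)[symmetric]) measurable
  also have "\<dots> = (\<integral>\<omega>. \<psi> \<omega> \<partial>M)"
    by (rule integral_cong_AE[OF _ \<psi> ae]) measurable
  finally show "(\<integral>\<omega>. \<phi> \<omega> * indicator (X_at (Suc t) v) \<omega> \<partial>M) = (\<integral>\<omega>. \<psi> \<omega> \<partial>M)" .
qed

section \<open>Propagation of infinitely many visits to the right\<close>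

text \<open>The numerator of the transition probability is at least \<open>c\<close> times its
  initial value and the denominator at most its initial value. Quantifying over all \<open>A\<close>
  in \<open>F t\<close> expresses a bound on the conditional probability that is uniform in time and
  past.\<close>

lemma step_right_prob:
  "\<exists>\<delta>>0. \<forall>t. \<forall>A\<in>sets (F t). A \<subseteq> X_at t x \<longrightarrow> \<delta> * prob A \<le> prob (A \<inter> X_at (Suc t) (Suc x))"
proof -
  define q where "q t \<omega> = (if x = 0 then 1 else
    C t \<omega> {x, Suc x} / (C t \<omega> {x - 1, Suc (x - 1)} + C t \<omega> {x, Suc x}))" for t \<omega>
  define \<delta> where "\<delta> = (if x = 0 then 1 else
    c * C0 {x, Suc x} / (C0 {x - 1, Suc (x - 1)} + C0 {x, Suc x}))"
  have "\<delta> > 0"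
    using c_pos C0_pos by (cases x) (simp_all add: \<delta>_def add_pos_pos)
  moreover have "\<delta> * prob A \<le> prob (A \<inter> X_at (Suc t) (Suc x))"
    if A: "A \<in> sets (F t)" "A \<subseteq> X_at t x" for t A
  proof -
    have [measurable]: "A \<in> sets M" "A \<in> sets (F t)" using A sets_F_M by auto
    have [measurable]: "q t \<in> borel_measurable M"
      unfolding q_def[abs_def] by measurable
    have tp: "AE \<omega> in M. indicator A \<omega> * transition_prob nat_edges (C t \<omega>) (X t \<omega>) (Suc x) = indicator A \<omega> * q t \<omega>"
      using C_pos
    proof eventually_elim
      case (elim \<omega>)
      then show ?case
        using A(2) by (cases x) (auto simp: indicator_def q_def nat_transition_prob_0 nat_transition_prob_Suc)
    qed
    note st = step_integral[where \<phi> = "indicator A" and K = 1, OF _ _ tp]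
    have int: "integrable M (\<lambda>\<omega>. indicator A \<omega> * q t \<omega>)"
      by (rule st) auto
    have "\<delta> * prob A = (\<integral>\<omega>. indicator A \<omega> * \<delta> \<partial>M)"
      by simp
    also have "\<dots> \<le> (\<integral>\<omega>. indicator A \<omega> * q t \<omega> \<partial>M)"
    proof (rule integral_mono_AE)
      show "AE \<omega> in M. indicator A \<omega> * \<delta> \<le> indicator A \<omega> * q t \<omega>"
        using C_bounds C_pos
      proof eventually_elim
        case (elim \<omega>)
        have "\<delta> \<le> q t \<omega>"
        proof (cases "x = 0")
          case False
          have "c * C0 {x, Suc x} / (C0 {x - 1, Suc (x - 1)} + C0 {x, Suc x})
             \<le> C t \<omega> {x, Suc x} / (C t \<omega> {x - 1, Suc (x - 1)} + C t \<omega> {x, Suc x})"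
            using elim c_pos C0_pos[of x] by (intro frac_le add_mono add_pos_pos) (auto simp: less_imp_le)
          then show ?thesis using False by (simp add: \<delta>_def q_def)
        qed (simp add: \<delta>_def q_def)
        then show ?case by (simp add: indicator_def)
      qed
    qed (use int in \<open>auto simp: emeasure_eq_measure\<close>)
    also have "\<dots> = (\<integral>\<omega>. indicator A \<omega> * indicator (X_at (Suc t) (Suc x)) \<omega> \<partial>M)"
      by (rule st(1)[symmetric]) auto
    also have "\<dots> = prob (A \<inter> X_at (Suc t) (Suc x))"
      by (simp add: indicator_inter_arith[symmetric] Int_absorb2 sets.sets_into_space)
    finally show ?thesis .
  qed
  ultimately show ?thesis by blast
qed

text \<open>A conditional Borel-Cantelli argument: for each fixed \<open>s\<close>, avoiding
  \<open>Suc x\<close> from time \<open>s\<close> on allows only finitely many visits to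
  \<open>x\<close>; countably many \<open>s\<close> suffice.\<close>

lemma infinitely_often_Suc:
  "AE \<omega> in M. infinite {t. X t \<omega> = x} \<longrightarrow> infinite {t. X t \<omega> = Suc x}"
proof -
  obtain \<delta> where \<delta>: "\<delta> > 0"
    "\<And>t A. A \<in> sets (F t) \<Longrightarrow> A \<subseteq> X_at t x \<Longrightarrow> \<delta> * prob A \<le> prob (A \<inter> X_at (Suc t) (Suc x))"
    using step_right_prob[of x] by blast
  have "AE \<omega> in M. (\<forall>t\<ge>s. X t \<omega> \<noteq> Suc x) \<longrightarrow> finite {t. X t \<omega> = x}" for s
  proof -
    \<comment> \<open>From each \<open>W t\<close> the first visit to \<open>Suc x\<close> after time \<open>s\<close> happens at time \<open>Suc t\<close> with
      probability at least \<open>\<delta>\<close>; these events are disjoint, so the \<open>prob (W t)\<close> are summable.\<close>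
    define W where "W t = {\<omega> \<in> space M. X t \<omega> = x \<and> (\<forall>u\<in>{s..t}. X u \<omega> \<noteq> Suc x)}" for t
    have W_F: "W t \<in> sets (F t)" for t
    proof -
      have "{\<omega> \<in> space (F t). X t \<omega> = x \<and> (\<forall>u\<in>{s..t}. X u \<omega> \<noteq> Suc x)} \<in> sets (F t)"
        using X_F_measurable by measurable auto
      then show ?thesis by (simp add: W_def)
    qed
    have [measurable]: "W t \<in> sets M" for t using W_F sets_F_M by blast
    have "summable (\<lambda>t. prob (W (t + s)))"
    proof (rule summableI_nonneg_bounded)
      fix n
      let ?U = "\<lambda>t. W (t + s) \<inter> X_at (Suc (t + s)) (Suc x)"
      have disj: "disjoint_family_on ?U {..<n}"
        unfolding disjoint_family_on_def
      proof (intro ballI impI)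
        fix a b :: nat assume "a \<noteq> b"
        then show "?U a \<inter> ?U b = {}"
        proof (induction a b rule: linorder_wlog)
          case (le a b)
          \<comment> \<open>A visit to \<open>Suc x\<close> at time \<open>Suc (a + s)\<close> is
            forbidden on \<open>W (b + s)\<close> as soon as \<open>a < b\<close>.\<close>
          then have "Suc (a + s) \<in> {s..b + s}" by auto
          then show ?case by (auto simp: W_def)
        next
          case (sym a b)
          then show ?case by blast
        qed
      qed
      have "\<delta> * (\<Sum>t<n. prob (W (t + s))) \<le> (\<Sum>t<n. prob (?U t))"
        unfolding sum_distrib_left
        by (intro sum_mono \<delta>(2) W_F) (auto simp: W_def)
      also have "\<dots> = prob (\<Union>t<n. ?U t)"
        by (rule finite_measure_finite_Union[symmetric]) (use disj in auto)
      also have "\<dots> \<le> 1" by (rule prob_le_1)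
      finally show "(\<Sum>t<n. prob (W (t + s))) \<le> 1 / \<delta>"
        using \<delta>(1) by (simp add: field_simps)
    qed auto
    then have "summable (\<lambda>t. prob (W t))"
      by (subst (asm) summable_iff_shift)
    \<comment> \<open>First Borel-Cantelli lemma. If \<open>Suc x\<close> is avoided from
      \<open>s\<close> on, then \<open>W t\<close> says no more than
      \<open>X t \<omega> = x\<close>.\<close>
    then have "AE \<omega> in M. eventually (\<lambda>t. \<omega> \<in> space M - W t) sequentially"
      by (intro borel_cantelli_AE1) (auto simp: emeasure_eq_measure)
    then show ?thesis
    proof eventually_elim
      case (elim \<omega>)
      then obtain m where m: "\<And>t. t \<ge> m \<Longrightarrow> \<omega> \<in> space M \<and> \<omega> \<notin> W t"
        by (auto simp: eventually_sequentially)
      show ?case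
      proof
        assume *: "\<forall>t\<ge>s. X t \<omega> \<noteq> Suc x"
        have "{t. X t \<omega> = x} \<subseteq> {..m}"
        proof
          fix t assume "t \<in> {t. X t \<omega> = x}"
          then show "t \<in> {..m}"
            using m[of t] * by (cases "t \<ge> m") (auto simp: W_def)
        qed
        then show "finite {t. X t \<omega> = x}" by (rule finite_subset) simp
      qed
    qed
  qed
  then have "AE \<omega> in M. \<forall>s. (\<forall>t\<ge>s. X t \<omega> \<noteq> Suc x) \<longrightarrow> finite {t. X t \<omega> = x}"
    unfolding AE_all_countable by blast
  then show ?thesis
  proof eventually_elim
    case (elim \<omega>)
    \<comment> \<open>If the visits to \<open>Suc x\<close> are finite in number, a strict bound on
      their times serves as \<open>s\<close>.\<close>
    then show ?case
      by (metis (mono_tags, lifting) finite_nat_set_iff_bounded mem_Collect_eq not_le)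
  qed
qed

lemma infinitely_often_le:
  "AE \<omega> in M. \<forall>x y. x \<le> y \<longrightarrow> infinite {t. X t \<omega> = x} \<longrightarrow> infinite {t. X t \<omega> = y}"
proof -
  have "AE \<omega> in M. \<forall>x. infinite {t. X t \<omega> = x} \<longrightarrow> infinite {t. X t \<omega> = Suc x}"
    using infinitely_often_Suc by (simp add: AE_all_countable)
  then show ?thesis
  proof eventually_elim
    case (elim \<omega>)
    show ?case
    proof (intro allI impI)
      fix x y :: nat
      assume "x \<le> y" "infinite {t. X t \<omega> = x}"
      then show "infinite {t. X t \<omega> = y}"
        using elim by (induction y rule: dec_induct) auto
    qed
  qed
qed

text \<open>A walk that stays below \<open>N\<close> visits some state below \<open>N\<close>
  infinitely often by pigeonhole, hence also \<open>N\<close>, a contradiction.\<close>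

lemma exits_bounded_interval:
  "AE \<omega> in M. \<exists>t\<ge>n. \<not> (0 < X t \<omega> \<and> X t \<omega> < N)"
  using infinitely_often_le
proof eventually_elim
  case (elim \<omega>)
  show ?case
  proof (rule ccontr)
    assume "\<not> ?thesis"
    then have *: "X t \<omega> < N" if "t \<ge> n" for t using that by blast
    have "(\<lambda>t. X t \<omega>) ` {n..} \<subseteq> {..<N}" using * by auto
    then have "finite ((\<lambda>t. X t \<omega>) ` {n..})" by (rule finite_subset) simp
    then obtain k where "k \<in> {n..}" "infinite {t \<in> {n..}. X t \<omega> = X k \<omega>}"
      using pigeonhole_infinite[of "{n..}" "\<lambda>t. X t \<omega>"] infinite_Ici by blast
    then have "X k \<omega> < N" "infinite {t. X t \<omega> = X k \<omega>}"
      using * by (auto elim: infinite_super[rotated])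
    then have "infinite {t. X t \<omega> = N}" using elim by (meson less_imp_le)
    moreover have "{t. X t \<omega> = N} \<subseteq> {..<n}" using * by (force simp: not_less[symmetric])
    ultimately show False using finite_subset by blast
  qed
qed


subsection \<open>The return probability to 0\<close>

text \<open>For \<open>x \<ge> N\<close> the sum is empty, so the value on passing \<open>N\<close>
  is 0 automatically.\<close>

definition resist :: "nat \<Rightarrow> nat \<Rightarrow> 'w \<Rightarrow> nat \<Rightarrow> real" where
  "resist N t \<omega> x = (\<Sum>j\<in>{x..<N}. 1 / C t \<omega> {j, Suc j})"

lemma resist_F_measurable [measurable]: "(\<lambda>\<omega>. resist N t \<omega> x) \<in> borel_measurable (F t)"
  unfolding resist_def by measurable

lemma resist_measurable [measurable]: "(\<lambda>\<omega>. resist N t \<omega> x) \<in> borel_measurable M"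
  unfolding resist_def by measurable

lemma resist_at_X_measurable [measurable]: "(\<lambda>\<omega>. resist N t \<omega> (X t \<omega>)) \<in> borel_measurable M"
  by (rule measurable_compose_countable[where g = "X t"]) measurable

text \<open>True at every point of the space: conductances are nonnegative everywhere, and a
  vanishing one contributes \<open>1 / 0 = 0\<close>.\<close>

lemma resist_nonneg: "\<omega> \<in> space M \<Longrightarrow> 0 \<le> resist N t \<omega> x"
  unfolding resist_def by (intro sum_nonneg) (simp add: C_nonneg)

text \<open>Conductances of at least \<open>c * C0\<close> raise each resistance by a factor of at
  most \<open>1 / c\<close>; extending the sum down to 0 makes the bound uniform in
  \<open>x\<close>.\<close>

lemma resist_le: "AE \<omega> in M. \<forall>N t x. resist N t \<omega> x \<le> (\<Sum>j<N. 1 / C0 {j, Suc j}) / c"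
  using C_bounds C_pos
proof eventually_elim
  case (elim \<omega>)
  show ?case
  proof (intro allI)
    fix N t x
    have "resist N t \<omega> x \<le> (\<Sum>j\<in>{x..<N}. 1 / C0 {j, Suc j} / c)"
      unfolding resist_def
    proof (rule sum_mono)
      fix j
      have "1 / C t \<omega> {j, Suc j} \<le> 1 / (c * C0 {j, Suc j})"
        using elim c_pos C0_pos[of j] by (intro divide_left_mono mult_pos_pos) auto
      then show "1 / C t \<omega> {j, Suc j} \<le> 1 / C0 {j, Suc j} / c"
        by (simp add: mult.commute)
    qed
    also have "\<dots> \<le> (\<Sum>j<N. 1 / C0 {j, Suc j} / c)"
      using c_pos C0_pos by (intro sum_mono2) (auto simp: less_imp_le)
    finally show "resist N t \<omega> x \<le> (\<Sum>j<N. 1 / C0 {j, Suc j}) / c"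
      by (simp add: sum_divide_distrib)
  qed
qed

text \<open>Bounds the random starting value of the submartingale below by a deterministic
  resistance, which can be pulled out of the integral.\<close>

lemma resist_ge: "AE \<omega> in M. \<forall>N t x. (\<Sum>j\<in>{x..<N}. 1 / C0 {j, Suc j}) \<le> resist N t \<omega> x"
  using C_bounds C_pos
proof eventually_elim
  case (elim \<omega>)
  then show ?case
    unfolding resist_def using C0_pos by (intro allI sum_mono divide_left_mono) auto
qed

lemma resist_mono: "AE \<omega> in M. \<forall>N t x. resist N t \<omega> x \<le> resist N (Suc t) \<omega> x"
  using C_mono C_pos
proof eventually_elim
  case (elim \<omega>)
  then show ?case
    unfolding resist_def by (intro allI sum_mono divide_left_mono) auto
qed

lemma integrable_bounded_indicator:
  fixes f :: "'w \<Rightarrow> real"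
  assumes [measurable]: "A \<in> sets M" "f \<in> borel_measurable M"
    and "AE \<omega> in M. 0 \<le> f \<omega> \<and> f \<omega> \<le> K"
  shows "integrable M (\<lambda>\<omega>. indicator A \<omega> * f \<omega>)"
  using assms(3) by (intro integrable_const_bound[where B = "\<bar>K\<bar>"]) (auto simp: indicator_def)

lemma integrable_resist:
  assumes [measurable]: "A \<in> sets M"
  shows "integrable M (\<lambda>\<omega>. indicator A \<omega> * resist N t \<omega> (X t \<omega>))"
    and "integrable M (\<lambda>\<omega>. indicator A \<omega> * resist N t \<omega> x)"
proof -
  have bounds: "AE \<omega> in M. 0 \<le> resist N t \<omega> (f \<omega>) \<and>
      resist N t \<omega> (f \<omega>) \<le> (\<Sum>j<N. 1 / C0 {j, Suc j}) / c" for f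
    using resist_le AE_space by eventually_elim (simp add: resist_nonneg)
  show "integrable M (\<lambda>\<omega>. indicator A \<omega> * resist N t \<omega> (X t \<omega>))"
    by (rule integrable_bounded_indicator[OF assms _ bounds]) measurable
  show "integrable M (\<lambda>\<omega>. indicator A \<omega> * resist N t \<omega> x)"
    by (rule integrable_bounded_indicator[OF assms _ bounds]) measurable
qed

section \<open>The resistance submartingale\<close>

text \<open>Moving the walk while the conductances stay frozen preserves the mean, because the
  resistance is harmonic; updating the conductances afterwards can only increase it.\<close>

lemma resist_submartingale_at:
  assumes A: "A \<in> sets (F t)" "A \<subseteq> X_at t (Suc y)" and N: "Suc y < N"
  shows "(\<integral>\<omega>. indicator A \<omega> * resist N t \<omega> (X t \<omega>) \<partial>M)
    \<le> (\<integral>\<omega>. indicator A \<omega> * resist N (Suc t) \<omega> (X (Suc t) \<omega>) \<partial>M)"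
proof -
  have [measurable]: "A \<in> sets M" "A \<in> sets (F t)" using A sets_F_M by auto
  let ?l = "\<lambda>\<omega>. C t \<omega> {y, Suc y}"
  let ?r = "\<lambda>\<omega>. C t \<omega> {Suc y, Suc (Suc y)}"
  \<comment> \<open>The endpoint \<open>x\<close> is deterministic here, so \<open>?\<phi> x\<close>
    belongs to the past at time \<open>t\<close> and can be tested against a step to
    \<open>x\<close>.\<close>
  let ?\<phi> = "\<lambda>x \<omega>. indicator A \<omega> * resist N t \<omega> x"
  define K where "K = (\<Sum>j<N. 1 / C0 {j, Suc j}) / c"
  have bnd: "AE \<omega> in M. \<bar>?\<phi> x \<omega>\<bar> \<le> \<bar>K\<bar>" for x
    using resist_le AE_space
  proof eventually_elim
    case (elim \<omega>)
    then have "resist N t \<omega> x \<le> K" unfolding K_def by blast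
    then show ?case using resist_nonneg[of \<omega> N t x] elim by (auto simp: indicator_def)
  qed
  have tl: "AE \<omega> in M. ?\<phi> y \<omega> * transition_prob nat_edges (C t \<omega>) (X t \<omega>) y
      = ?\<phi> y \<omega> * (?l \<omega> / (?l \<omega> + ?r \<omega>))"
    using A(2) by (intro AE_I2) (auto simp: indicator_def nat_transition_prob_Suc)
  have tr: "AE \<omega> in M. ?\<phi> (Suc (Suc y)) \<omega> * transition_prob nat_edges (C t \<omega>) (X t \<omega>) (Suc (Suc y))
      = ?\<phi> (Suc (Suc y)) \<omega> * (?r \<omega> / (?l \<omega> + ?r \<omega>))"
    using A(2) by (intro AE_I2) (auto simp: indicator_def nat_transition_prob_Suc)
  have L: "(\<integral>\<omega>. ?\<phi> y \<omega> * indicator (X_at (Suc t) y) \<omega> \<partial>M) = (\<integral>\<omega>. ?\<phi> y \<omega> * (?l \<omega> / (?l \<omega> + ?r \<omega>)) \<partial>M)"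
      "integrable M (\<lambda>\<omega>. ?\<phi> y \<omega> * (?l \<omega> / (?l \<omega> + ?r \<omega>)))"
    by (rule step_integral[OF _ bnd tl]; measurable)+
  have R: "(\<integral>\<omega>. ?\<phi> (Suc (Suc y)) \<omega> * indicator (X_at (Suc t) (Suc (Suc y))) \<omega> \<partial>M)
        = (\<integral>\<omega>. ?\<phi> (Suc (Suc y)) \<omega> * (?r \<omega> / (?l \<omega> + ?r \<omega>)) \<partial>M)"
      "integrable M (\<lambda>\<omega>. ?\<phi> (Suc (Suc y)) \<omega> * (?r \<omega> / (?l \<omega> + ?r \<omega>)))"
    by (rule step_integral[OF _ bnd tr]; measurable)+
  have int: "integrable M (\<lambda>\<omega>. ?\<phi> x \<omega> * indicator (X_at (Suc t) x) \<omega>)" for x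
    using integrable_mult_indicator[OF _ integrable_resist(2), of "X_at (Suc t) x" A N t x]
    by (simp add: mult.commute)
  have "(\<integral>\<omega>. indicator A \<omega> * resist N t \<omega> (X t \<omega>) \<partial>M) =
      (\<integral>\<omega>. ?\<phi> y \<omega> * (?l \<omega> / (?l \<omega> + ?r \<omega>)) + ?\<phi> (Suc (Suc y)) \<omega> * (?r \<omega> / (?l \<omega> + ?r \<omega>)) \<partial>M)"
  proof (rule integral_cong_AE)
    show "AE \<omega> in M. indicator A \<omega> * resist N t \<omega> (X t \<omega>) =
      ?\<phi> y \<omega> * (?l \<omega> / (?l \<omega> + ?r \<omega>)) + ?\<phi> (Suc (Suc y)) \<omega> * (?r \<omega> / (?l \<omega> + ?r \<omega>))"
      using C_pos
    proof eventually_elim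
      case (elim \<omega>)
      let ?g = "resist N t \<omega>"
      have lr: "?l \<omega> > 0" "?r \<omega> > 0" using elim by auto
      have g: "?g y = ?g (Suc y) + 1 / ?l \<omega>" "?g (Suc y) = ?g (Suc (Suc y)) + 1 / ?r \<omega>"
        using N by (simp_all add: resist_def sum.atLeast_Suc_lessThan)
      \<comment> \<open>The gain \<open>1 / ?l \<omega>\<close> and the loss
        \<open>1 / ?r \<omega>\<close>, each weighted by its probability, cancel.\<close>
      have "?g y * (?l \<omega> / (?l \<omega> + ?r \<omega>)) + ?g (Suc (Suc y)) * (?r \<omega> / (?l \<omega> + ?r \<omega>)) = ?g (Suc y)"
        unfolding g using lr by (simp add: divide_simps) (simp add: algebra_simps)
      then show ?case
        using A(2) by (auto simp: indicator_def)
    qed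
  qed measurable
  also have "\<dots> = (\<integral>\<omega>. ?\<phi> y \<omega> * indicator (X_at (Suc t) y) \<omega>
      + ?\<phi> (Suc (Suc y)) \<omega> * indicator (X_at (Suc t) (Suc (Suc y))) \<omega> \<partial>M)"
    using L R int by simp
  \<comment> \<open>At the two neighbours this is \<open>resist_mono\<close>; elsewhere the left
    side vanishes and the right side is nonnegative.\<close>
  also have "\<dots> \<le> (\<integral>\<omega>. indicator A \<omega> * resist N (Suc t) \<omega> (X (Suc t) \<omega>) \<partial>M)"
  proof (rule integral_mono_AE)
    show "AE \<omega> in M. ?\<phi> y \<omega> * indicator (X_at (Suc t) y) \<omega>
      + ?\<phi> (Suc (Suc y)) \<omega> * indicator (X_at (Suc t) (Suc (Suc y))) \<omega>
      \<le> indicator A \<omega> * resist N (Suc t) \<omega> (X (Suc t) \<omega>)"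
      using resist_mono AE_space
    proof eventually_elim
      case (elim \<omega>)
      then show ?case using resist_nonneg[of \<omega>] by (auto simp: indicator_def)
    qed
  qed (use int integrable_resist(1) in auto)
  finally show ?thesis .
qed

text \<open>Only finitely many positions occur on \<open>A\<close>, so the statement is a finite sum
  of its versions at a fixed position.\<close>

lemma resist_submartingale:
  assumes A: "A \<in> sets (F t)" "\<And>\<omega>. \<omega> \<in> A \<Longrightarrow> 0 < X t \<omega> \<and> X t \<omega> < N"
  shows "(\<integral>\<omega>. indicator A \<omega> * resist N t \<omega> (X t \<omega>) \<partial>M)
    \<le> (\<integral>\<omega>. indicator A \<omega> * resist N (Suc t) \<omega> (X (Suc t) \<omega>) \<partial>M)"
proof -
  let ?A = "\<lambda>x. A \<inter> X_at t x"
  have AM: "A \<in> sets M" using A sets_F_M by auto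
  have AF: "?A x \<in> sets (F t)" for x
  proof -
    have "{\<omega> \<in> space (F t). X t \<omega> = x} \<in> sets (F t)" by measurable
    then show ?thesis using A(1) by auto
  qed
  have split: "(\<integral>\<omega>. indicator A \<omega> * f \<omega> \<partial>M) = (\<Sum>x\<in>{1..<N}. \<integral>\<omega>. indicator (?A x) \<omega> * f \<omega> \<partial>M)"
    if "\<And>B. B \<in> sets M \<Longrightarrow> integrable M (\<lambda>\<omega>. indicator B \<omega> * f \<omega>)" for f :: "'w \<Rightarrow> real"
  proof -
    have "(\<integral>\<omega>. indicator A \<omega> * f \<omega> \<partial>M) = (\<integral>\<omega>. (\<Sum>x\<in>{1..<N}. indicator (?A x) \<omega> * f \<omega>) \<partial>M)"
    proof (rule Bochner_Integration.integral_cong[OF refl])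
      fix \<omega> assume "\<omega> \<in> space M"
      then show "indicator A \<omega> * f \<omega> = (\<Sum>x\<in>{1..<N}. indicator (?A x) \<omega> * f \<omega>)"
        using A(2)[of \<omega>] by (cases "\<omega> \<in> A") (auto simp: indicator_def if_distrib sum.delta' cong: if_cong)
    qed
    also have "\<dots> = (\<Sum>x\<in>{1..<N}. \<integral>\<omega>. indicator (?A x) \<omega> * f \<omega> \<partial>M)"
      using AF sets_F_M by (intro Bochner_Integration.integral_sum that) blast
    finally show ?thesis .
  qed
  have split_resist: "(\<integral>\<omega>. indicator A \<omega> * resist N s \<omega> (X s \<omega>) \<partial>M)
    = (\<Sum>x\<in>{1..<N}. \<integral>\<omega>. indicator (?A x) \<omega> * resist N s \<omega> (X s \<omega>) \<partial>M)" for s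
    by (intro split integrable_resist(1))
  show ?thesis
    unfolding split_resist
  proof (rule sum_mono)
    fix x assume "x \<in> {1..<N}"
    then obtain y where "x = Suc y" "Suc y < N" by (cases x) auto
    then show "(\<integral>\<omega>. indicator (?A x) \<omega> * resist N t \<omega> (X t \<omega>) \<partial>M)
      \<le> (\<integral>\<omega>. indicator (?A x) \<omega> * resist N (Suc t) \<omega> (X (Suc t) \<omega>) \<partial>M)"
      using AF by (auto intro!: resist_submartingale_at)
  qed
qed

text \<open>Optional stopping at the exit from the interval, written with events instead of a
  stopping time. The start contributes at least the left-hand resistance, the exit at
  \<open>N\<close> nothing, and the exit at 0 at most \<open>K\<close>.\<close>

lemma resist_bound_visit_0:
  assumes A: "A \<in> sets (F n)" "A \<subseteq> X_at n x" and x: "0 < x" "x < N"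
  shows "(\<Sum>j\<in>{x..<N}. 1 / C0 {j, Suc j}) * prob A
    \<le> (\<Sum>j<N. 1 / C0 {j, Suc j}) / c * prob {\<omega> \<in> A. \<exists>t\<ge>n. X t \<omega> = 0}"
proof -
  define K where "K = (\<Sum>j<N. 1 / C0 {j, Suc j}) / c"
  \<comment> \<open>\<open>D t\<close> means no exit so far, \<open>H t\<close> a visit to 0 so far.
    \<open>H t\<close> also admits visits made after passing \<open>N\<close>, which is harmless for
    a lower bound on visits to 0.\<close>
  define D where "D t = {\<omega> \<in> A. \<forall>u\<in>{n..t}. 0 < X u \<omega> \<and> X u \<omega> < N}" for t
  define H where "H t = {\<omega> \<in> A. \<exists>u\<in>{n..t}. X u \<omega> = 0}" for t
  define a where "a t = (\<integral>\<omega>. indicator (D t) \<omega> * resist N t \<omega> (X t \<omega>) \<partial>M)" for t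
  have [measurable]: "A \<in> sets M" using A sets_F_M by auto
  then have AS: "A \<subseteq> space M" by (rule sets.sets_into_space)
  have K: "0 \<le> K" unfolding K_def using c_pos C0_pos by (auto intro!: divide_nonneg_pos sum_nonneg simp: less_imp_le)
  have K_bound: "AE \<omega> in M. \<forall>t x. 0 \<le> resist N t \<omega> x \<and> resist N t \<omega> x \<le> K"
    using resist_le AE_space by eventually_elim (auto simp: K_def resist_nonneg)
  have DF: "D t \<in> sets (F t)" if "n \<le> t" for t
  proof -
    have "{\<omega> \<in> space (F t). \<forall>u\<in>{n..t}. 0 < X u \<omega> \<and> X u \<omega> < N} \<in> sets (F t)"
      using X_F_measurable by measurable auto
    moreover have "A \<in> sets (F t)" using A(1) F_mono that by blast
    ultimately have "A \<inter> {\<omega> \<in> space (F t). \<forall>u\<in>{n..t}. 0 < X u \<omega> \<and> X u \<omega> < N} \<in> sets (F t)" by auto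
    also have "A \<inter> {\<omega> \<in> space (F t). \<forall>u\<in>{n..t}. 0 < X u \<omega> \<and> X u \<omega> < N} = D t"
      using AS by (auto simp: D_def)
    finally show ?thesis .
  qed
  have D_alt: "D t = A \<inter> {\<omega> \<in> space M. \<forall>u\<in>{n..t}. 0 < X u \<omega> \<and> X u \<omega> < N}"
    and H_alt: "H t = A \<inter> {\<omega> \<in> space M. \<exists>u\<in>{n..t}. X u \<omega> = 0}"
    and V_alt: "{\<omega> \<in> A. \<exists>t\<ge>n. X t \<omega> = 0} = A \<inter> {\<omega> \<in> space M. \<exists>t\<ge>n. X t \<omega> = 0}" for t
    using AS by (auto simp: D_def H_def)
  have [measurable]: "D t \<in> sets M" "H t \<in> sets M" "{\<omega> \<in> A. \<exists>t\<ge>n. X t \<omega> = 0} \<in> sets M" for t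
    unfolding D_alt H_alt V_alt by measurable
  have submart: "a t + K * prob (H t) \<le> a (Suc t) + K * prob (H (Suc t))" if "n \<le> t" for t
  proof -
    have "a t \<le> (\<integral>\<omega>. indicator (D t) \<omega> * resist N (Suc t) \<omega> (X (Suc t) \<omega>) \<partial>M)"
      unfolding a_def using that by (intro resist_submartingale DF) (auto simp: D_def)
    moreover have "(\<integral>\<omega>. indicator (D t) \<omega> * resist N (Suc t) \<omega> (X (Suc t) \<omega>) \<partial>M) + K * prob (H t)
      = (\<integral>\<omega>. indicator (D t) \<omega> * resist N (Suc t) \<omega> (X (Suc t) \<omega>) + K * indicator (H t) \<omega> \<partial>M)"
      using integrable_resist(1)[of "D t" N "Suc t"]
      by (subst Bochner_Integration.integral_add) (auto simp: emeasure_eq_measure)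
    moreover have "\<dots> \<le> (\<integral>\<omega>. indicator (D (Suc t)) \<omega> * resist N (Suc t) \<omega> (X (Suc t) \<omega>) + K * indicator (H (Suc t)) \<omega> \<partial>M)"
    \<comment> \<open>A pathwise comparison: on reaching 0 a resistance of at most \<open>K\<close>
      is traded for \<open>K\<close>, inside the interval the term is kept, and at or beyond
      \<open>N\<close> it is 0.\<close>
    proof (rule integral_mono_AE)
      show "AE \<omega> in M. indicator (D t) \<omega> * resist N (Suc t) \<omega> (X (Suc t) \<omega>) + K * indicator (H t) \<omega>
        \<le> indicator (D (Suc t)) \<omega> * resist N (Suc t) \<omega> (X (Suc t) \<omega>) + K * indicator (H (Suc t)) \<omega>"
        using K_bound
      proof eventually_elim
        case (elim \<omega>)
        have iv: "{n..Suc t} = insert (Suc t) {n..t}" using that by auto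
        have g: "0 \<le> resist N (Suc t) \<omega> (X (Suc t) \<omega>)" "resist N (Suc t) \<omega> (X (Suc t) \<omega>) \<le> K"
          using elim by auto
        show ?case
        proof (cases "\<omega> \<in> D t")
          case True
          then have "\<omega> \<notin> H t" by (auto simp: D_def H_def)
          consider "X (Suc t) \<omega> = 0" | "0 < X (Suc t) \<omega>" "X (Suc t) \<omega> < N" | "N \<le> X (Suc t) \<omega>" by linarith
          then show ?thesis
          proof cases
            case 1
            then have "\<omega> \<in> H (Suc t)" "\<omega> \<notin> D (Suc t)" using True by (auto simp: D_def H_def iv)
            then show ?thesis using g \<open>\<omega> \<notin> H t\<close> True by simp
          next
            case 2
            then have "\<omega> \<in> D (Suc t)" using True by (auto simp: D_def iv)
            then show ?thesis using g K \<open>\<omega> \<notin> H t\<close> True by simp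
          next
            case 3
            then have "resist N (Suc t) \<omega> (X (Suc t) \<omega>) = 0" by (simp add: resist_def)
            then show ?thesis using K \<open>\<omega> \<notin> H t\<close> by simp
          qed
        next
          case False
          have "H t \<subseteq> H (Suc t)" by (auto simp: H_def)
          then show ?thesis using False g K by (auto simp: indicator_def)
        qed
      qed
    qed (use integrable_resist(1) in \<open>auto simp: emeasure_eq_measure intro!: Bochner_Integration.integrable_add\<close>)
    moreover have "\<dots> = a (Suc t) + K * prob (H (Suc t))"
      unfolding a_def using integrable_resist(1)[of "D (Suc t)" N "Suc t"]
      by (subst Bochner_Integration.integral_add) (auto simp: emeasure_eq_measure)
    ultimately show ?thesis by linarith
  qed
  have iter: "a n + K * prob (H n) \<le> a t + K * prob (H t)" if "n \<le> t" for t
    using that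
  proof (induction t rule: dec_induct)
    case (step t)
    then show ?case using submart[of t] by linarith
  qed simp
  let ?V = "{\<omega> \<in> A. \<exists>t\<ge>n. X t \<omega> = 0}"
  have a_bound: "a n \<le> K * prob (D t) + K * prob ?V" if "n \<le> t" for t
  proof -
    have "a t \<le> (\<integral>\<omega>. indicator (D t) \<omega> * K \<partial>M)"
      unfolding a_def
    proof (rule integral_mono_AE)
      show "AE \<omega> in M. indicator (D t) \<omega> * resist N t \<omega> (X t \<omega>) \<le> indicator (D t) \<omega> * K"
        using K_bound by eventually_elim (simp add: indicator_def)
    qed (use integrable_resist(1) in \<open>auto simp: emeasure_eq_measure\<close>)
    then have "a t \<le> K * prob (D t)" by (simp add: mult.commute)
    moreover have "prob (H t) \<le> prob ?V"
      by (rule finite_measure_mono) (auto simp: H_def)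
    then have "K * prob (H t) \<le> K * prob ?V"
      using K by (rule mult_left_mono)
    moreover have "0 \<le> K * prob (H n)" using K by simp
    ultimately show ?thesis using iter[OF that] by linarith
  qed
  \<comment> \<open>The part still inside the interval disappears in the limit, since the walk
    almost surely exits.\<close>
  have "(\<lambda>t. prob (D t)) \<longlonglongrightarrow> prob (\<Inter>t. D t)"
    by (rule finite_Lim_measure_decseq) (auto simp: decseq_def D_def)
  also have "prob (\<Inter>t. D t) = 0"
  proof -
    have "AE \<omega> in M. \<omega> \<notin> (\<Inter>t. D t)"
      using exits_bounded_interval[of n N]
    proof eventually_elim
      case (elim \<omega>)
      then obtain t where "t \<ge> n" "\<not> (0 < X t \<omega> \<and> X t \<omega> < N)" by blast
      then have "\<omega> \<notin> D t" by (auto simp: D_def intro!: bexI[of _ t])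
      then show ?case by blast
    qed
    then show ?thesis by (subst prob_eq_0) auto
  qed
  finally have "(\<lambda>t. K * prob (D t) + K * prob ?V) \<longlonglongrightarrow> K * 0 + K * prob ?V"
    by (intro tendsto_intros)
  then have "a n \<le> K * prob ?V"
    using a_bound by (intro LIMSEQ_le_const[of _ "K * prob ?V" "a n"]) auto
  moreover have "(\<Sum>j\<in>{x..<N}. 1 / C0 {j, Suc j}) * prob A \<le> a n"
  proof -
    have "D n = A" using A(2) x by (auto simp: D_def)
    have "(\<Sum>j\<in>{x..<N}. 1 / C0 {j, Suc j}) * prob A = (\<integral>\<omega>. indicator A \<omega> * (\<Sum>j\<in>{x..<N}. 1 / C0 {j, Suc j}) \<partial>M)"
      by simp
    also have "\<dots> \<le> a n"
      unfolding a_def \<open>D n = A\<close>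
    proof (rule integral_mono_AE)
      show "AE \<omega> in M. indicator A \<omega> * (\<Sum>j\<in>{x..<N}. 1 / C0 {j, Suc j}) \<le> indicator A \<omega> * resist N n \<omega> (X n \<omega>)"
        using resist_ge
      proof eventually_elim
        case (elim \<omega>)
        then show ?case using A(2) by (auto simp: indicator_def)
      qed
    qed (use integrable_resist(1) in \<open>auto simp: emeasure_eq_measure\<close>)
    finally show ?thesis .
  qed
  ultimately show ?thesis by (simp add: K_def)
qed

section \<open>A uniform lower bound on the conditional return probability\<close>

lemma c_le_1: "c \<le> 1"
proof -
  have "AE \<omega> in M. c \<le> 1"
    using C_bounds
  proof eventually_elim
    case (elim \<omega>)
    then have "c * C0 {0, Suc 0} \<le> C0 {0, Suc 0}" by (meson order_trans)
    then show ?case using C0_pos[of 0] by simp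
  qed
  then show ?thesis by simp
qed

text \<open>Let \<open>N\<close> grow in the preceding bound: the resistance from \<open>x\<close>
  to \<open>N\<close> and that from 0 to \<open>N\<close> have ratio tending to 1, because the
  series diverges.\<close>

lemma visit_0_prob_at:
  assumes A: "A \<in> sets (F n)" "A \<subseteq> X_at n x"
  shows "c * prob A \<le> prob {\<omega> \<in> A. \<exists>t\<ge>n. X t \<omega> = 0}"
proof (cases "x = 0")
  case True
  then have "{\<omega> \<in> A. \<exists>t\<ge>n. X t \<omega> = 0} = A" using A(2) by auto
  then show ?thesis using c_le_1 by (simp add: mult_left_le_one_le c_pos less_imp_le)
next
  case False
  define S where "S N = (\<Sum>j<N. 1 / C0 {j, Suc j})" for N
  let ?V = "prob {\<omega> \<in> A. \<exists>t\<ge>n. X t \<omega> = 0}"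
  have S_mono: "S m \<le> S N" if "m \<le> N" for m N
    unfolding S_def using that C0_pos by (intro sum_mono2) (auto simp: less_imp_le)
  have main: "(S N - S x) * (c * prob A) \<le> S N * ?V" if "x < N" for N
  proof -
    have "S N = S x + (\<Sum>j\<in>{x..<N}. 1 / C0 {j, Suc j})"
      unfolding S_def lessThan_atLeast0 using that by (simp add: sum.atLeastLessThan_concat)
    then have "(S N - S x) * prob A \<le> S N / c * ?V"
      using resist_bound_visit_0[OF A _ that] False by (simp add: S_def)
    then show ?thesis using c_pos by (simp add: field_simps)
  qed
  show ?thesis
  proof (rule ccontr)
    assume "\<not> ?thesis"
    then have d: "c * prob A - ?V > 0" by simp
    \<comment> \<open>A strict deficit would bound all partial sums: solving \<open>main\<close> for
      \<open>S N\<close> gives the second entry, and the first covers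
      \<open>N \<le> x\<close>.\<close>
    have "S N \<le> max (S (Suc x)) (S x * (c * prob A) / (c * prob A - ?V))" for N
    proof (cases "x < N")
      case True
      then have "S N * (c * prob A - ?V) \<le> S x * (c * prob A)"
        using main[of N] by (simp add: algebra_simps)
      then have "S N \<le> S x * (c * prob A) / (c * prob A - ?V)" using d by (simp add: pos_le_divide_eq)
      then show ?thesis by simp
    next
      case False
      then have "S N \<le> S (Suc x)" by (intro S_mono) auto
      then show ?thesis by simp
    qed
    then have "summable (\<lambda>j. 1 / C0 {j, Suc j})"
      unfolding S_def using C0_pos by (intro summableI_nonneg_bounded) (auto simp: less_imp_le)
    then show False using C0_recurrent by blast
  qed
qed

text \<open>Sums the bound over the countably many positions at time \<open>n\<close>; the constant
  \<open>c\<close> does not depend on the position.\<close>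

lemma visit_0_prob:
  assumes A: "A \<in> sets (F n)"
  shows "c * prob A \<le> prob {\<omega> \<in> A. \<exists>t\<ge>n. X t \<omega> = 0}"
proof -
  let ?V = "\<lambda>A. {\<omega> \<in> A. \<exists>t\<ge>n. X t \<omega> = 0}"
  let ?A = "\<lambda>x. A \<inter> X_at n x"
  have AS: "A \<subseteq> space M" using sets.sets_into_space[OF sets_F_M[OF A]] .
  have AF: "?A x \<in> sets (F n)" for x
  proof -
    have "{\<omega> \<in> space (F n). X n \<omega> = x} \<in> sets (F n)" by measurable
    then show ?thesis using A by auto
  qed
  have AM [measurable]: "?A x \<in> sets M" for x using AF sets_F_M by blast
  have VM: "?V (?A x) \<in> sets M" for x
  proof -
    have "?V (?A x) = ?A x \<inter> {\<omega> \<in> space M. \<exists>t\<ge>n. X t \<omega> = 0}" by auto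
    also have "\<dots> \<in> sets M" by measurable
    finally show ?thesis .
  qed
  have "(\<lambda>x. prob (?A x)) sums prob (\<Union>x. ?A x)"
    using AM by (intro finite_measure_UNION) (auto simp: disjoint_family_on_def)
  moreover have "(\<Union>x. ?A x) = A" using AS by auto
  ultimately have 1: "(\<lambda>x. c * prob (?A x)) sums (c * prob A)"
    by (intro sums_mult) simp
  have "(\<lambda>x. prob (?V (?A x))) sums prob (\<Union>x. ?V (?A x))"
  proof (rule finite_measure_UNION)
    show "range (\<lambda>x. ?V (?A x)) \<subseteq> sets M" using VM by (rule image_subsetI)
    show "disjoint_family (\<lambda>x. ?V (?A x))" by (auto simp: disjoint_family_on_def)
  qed
  moreover have "(\<Union>x. ?V (?A x)) = ?V A" using AS by auto
  ultimately have 2: "(\<lambda>x. prob (?V (?A x))) sums prob (?V A)" by simp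
  show ?thesis
    by (rule sums_le[OF _ 1 2]) (rule visit_0_prob_at[OF AF Int_lower2])
qed

text \<open>
  The Levy 0-1 argument without martingale convergence: with \<open>A n\<close> decreasing to \<open>B\<close>, the
  conditional return probability gives \<open>c P(B) \<le> P(A n) - P(B)\<close>, which tends to 0.
\<close>

lemma visits_0_after: "AE \<omega> in M. \<exists>t\<ge>s. X t \<omega> = 0"
proof -
  define A where "A n = {\<omega> \<in> space M. \<forall>t\<in>{s..n}. X t \<omega> \<noteq> 0}" for n
  define B where "B = {\<omega> \<in> space M. \<forall>t\<ge>s. X t \<omega> \<noteq> 0}"
  have AF: "A n \<in> sets (F n)" for n
  proof -
    have "{\<omega> \<in> space (F n). \<forall>t\<in>{s..n}. X t \<omega> \<noteq> 0} \<in> sets (F n)"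
      using X_F_measurable by measurable auto
    then show ?thesis by (simp add: A_def)
  qed
  have [measurable]: "A n \<in> sets M" for n using AF sets_F_M by blast
  have [measurable]: "B \<in> sets M" unfolding B_def by measurable
  have BA: "B \<subseteq> A n" for n by (auto simp: A_def B_def)
  have "(\<Inter>n. A n) = B"
    by (auto simp: A_def B_def) (meson atLeastAtMost_iff order_refl)
  moreover have "(\<lambda>n. prob (A n)) \<longlonglongrightarrow> prob (\<Inter>n. A n)"
    by (rule finite_Lim_measure_decseq) (auto simp: decseq_def A_def)
  ultimately have "(\<lambda>n. prob (A n) - prob B) \<longlonglongrightarrow> prob B - prob B"
    by (intro tendsto_intros) simp
  moreover have "c * prob B \<le> prob (A n) - prob B" if "n \<ge> s" for n
  proof -
    have "c * prob B \<le> c * prob (A n)"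
      using c_pos BA by (intro mult_left_mono finite_measure_mono) auto
    also have "\<dots> \<le> prob {\<omega> \<in> A n. \<exists>t\<ge>n. X t \<omega> = 0}"
      by (rule visit_0_prob[OF AF])
    \<comment> \<open>As \<open>n \<ge> s\<close>, a visit to 0 at or after time \<open>n\<close>
      takes the path out of \<open>B\<close>.\<close>
    also have "\<dots> \<le> prob (A n - B)"
      using that by (intro finite_measure_mono) (auto simp: B_def, metis le_trans less_irrefl)
    also have "\<dots> = prob (A n) - prob B"
      using BA by (intro finite_measure_Diff) auto
    finally show ?thesis .
  qed
  ultimately have "c * prob B \<le> 0"
    by (intro LIMSEQ_le_const[of _ 0 "c * prob B"]) auto
  then have "prob B = 0"
    using c_pos by (simp add: mult_le_0_iff measure_le_0_iff)
  then have "AE \<omega> in M. \<omega> \<notin> B" by (subst (asm) prob_eq_0) auto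
  then show ?thesis
    using AE_space by eventually_elim (auto simp: B_def)
qed

lemma recurrent: "recurrent_walk M UNIV X"
proof -
  have "AE \<omega> in M. \<forall>s. \<exists>t\<ge>s. X t \<omega> = 0"
    using visits_0_after by (simp add: AE_all_countable)
  then show ?thesis
    unfolding recurrent_walk_def using infinitely_often_le
  proof eventually_elim
    case (elim \<omega>)
    then have "infinite {t. X t \<omega> = 0}" by (simp add: infinite_nat_iff_unbounded_le)
    then show ?case using elim by blast
  qed
qed

end

theorem theorem4p4:
  fixes M :: "'w measure"
    and X :: "nat \<Rightarrow> 'w \<Rightarrow> nat"
    and C :: "nat \<Rightarrow> 'w \<Rightarrow> nat set \<Rightarrow> real"
    and C0 Cinf :: "nat set \<Rightarrow> real"
    and c :: real
  assumes "rwce M (UNIV :: nat set) nat_edges X C"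
    and "proper_env M nat_edges C"
    and "monotone_decreasing_env M nat_edges C"
    and "AE \<omega> in M. \<forall>e\<in>nat_edges. C 0 \<omega> e = C0 e"
    and "recurrent_graph (UNIV :: nat set) nat_edges C0"
    and "c > 0"
    and "\<forall>e\<in>nat_edges. Cinf e = c * C0 e"
    and "env_bounded_below M nat_edges C Cinf"
  shows "recurrent_walk M (UNIV :: nat set) X"
proof -
  interpret rwce M UNIV nat_edges X C by fact
  note proper = assms(2)[unfolded proper_env_def]
  note mono = assms(3)[unfolded monotone_decreasing_env_def]
  note below = assms(8)[unfolded env_bounded_below_def]
  have "AE \<omega> in M. \<forall>e\<in>nat_edges. 0 < C0 e"
    using proper assms(4) by eventually_elim metis
  \<comment> \<open>An almost sure statement without \<open>\<omega>\<close> holds outright on a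
    probability space.\<close>
  then have C0_pos: "0 < C0 {j, Suc j}" for j by simp
  interpret nat_rwce M X C C0 c
  proof
    show "AE \<omega> in M. \<forall>t j. C (Suc t) \<omega> {j, Suc j} \<le> C t \<omega> {j, Suc j}"
      using mono by eventually_elim simp
    show "AE \<omega> in M. \<forall>t j. c * C0 {j, Suc j} \<le> C t \<omega> {j, Suc j} \<and> C t \<omega> {j, Suc j} \<le> C0 {j, Suc j}"
      using mono assms(4) below
    proof eventually_elim
      case (elim \<omega>)
      \<comment> \<open>Monotonicity iterated down to time 0, where the conductance is the
        deterministic \<open>C0\<close>.\<close>
      have "C t \<omega> {j, Suc j} \<le> C 0 \<omega> {j, Suc j}" for t j
        using elim(1) by (induction t) (simp, meson Suc_edge_in_nat_edges order_trans)
      then show ?case using elim assms(7) by simp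
    qed
    show "\<not> summable (\<lambda>j. 1 / C0 {j, Suc j})"
      using recurrent_nat_not_summable[of C0] C0_pos assms(5) by blast
  qed (fact assms(6), fact C0_pos)
  show ?thesis by (rule recurrent)
qed

end
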